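(* Let $\mathcal{H}$ be a Hilbert space and let $T\in B(\mathcal{H})$ be a near-isometry. Then $\mathcal{H}$ can be decomposed into two reducing subspaces of $T$ as $\mathcal{H}=\mathcal{H}_0\oplus\mathcal{H}_1$ such that $T$ is a shift on $\mathcal{H}_0$ and $T$ is invertible on $\mathcal{H}_1$. Moreover, $$\mathcal{H}_0=\bigoplus_{m=0}^{\infty}T^m\mathcal{W},\qquad \mathcal{H}_1=\bigcap_{m=0}^{\infty}T^m\mathcal{H},$$ where $\mathcal{W}=\mathcal{H}\ominus T\mathcal{H}$.
   Context: An operator $T\in B(\mathcal{H})$ on a Hilbert space $\mathcal{H}$ is a near-isometry if (i) there is a constant $\delta>0$ such that $\delta\|x\|\le\|Tx\|\le\|x\|$ for all $x\in\mathcal{H}$, and (ii) for each $k\ge1$, $T^{*k}T^{k+1}\mathcal{H}\subseteq T\mathcal{H}$. A closed subspace $\mathcal{W}$ of $\mathcal{H}$ is a wandering subspace for $T\in B(\mathcal{H})$ if $T^k\mathcal{W}\perp T^l\mathcal{W}$ whenever $k\neq l$ ($k,l\ge 0$). An operator $T\in B(\mathcal{H})$ is a shift on $\mathcal{H}$ if there is a wandering subspace $\mathcal{W}$ of $T$ with $\mathcal{H}=\bigoplus_{k=0}^\infty T^k\mathcal{W}$ (orthogonal Hilbert space direct sum). "$T$ is a shift (invertible) on a reducing subspace" refers to the restriction of $T$ to that subspace, as an operator on it. $\mathcal{H}\ominus T\mathcal{H}$ denotes the orthogonal complement of $T\mathcal{H}$ in $\mathcal{H}$. *)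

theory Defs
  imports "HOL-Analysis.Analysis"
begin

section \<open>Complex Hilbert spaces\<close>

text \<open>
  HOL-Analysis only provides real inner products.  The real inner product of a complex inner
  product space is the real part of the complex one, so norm and topology are the usual ones.
  The complex inner product is linear in the first argument.
\<close>

class complex_inner = real_inner +
  fixes scaleC :: "complex \<Rightarrow> 'a \<Rightarrow> 'a" (infixr \<open>*\<^sub>C\<close> 75)
    and cinner :: "'a \<Rightarrow> 'a \<Rightarrow> complex"
  assumes scaleC_add_right: "c *\<^sub>C (x + y) = c *\<^sub>C x + c *\<^sub>C y"
    and scaleC_add_left: "(c + d) *\<^sub>C x = c *\<^sub>C x + d *\<^sub>C x"
    and scaleC_scaleC: "c *\<^sub>C d *\<^sub>C x = (c * d) *\<^sub>C x"
    and scaleR_scaleC: "r *\<^sub>R x = complex_of_real r *\<^sub>C x"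
    and cinner_commute: "cinner x y = cnj (cinner y x)"
    and cinner_add_left: "cinner (x + y) z = cinner x z + cinner y z"
    and cinner_scaleC_left: "cinner (c *\<^sub>C x) y = c * cinner x y"
    and inner_eq_Re_cinner: "inner x y = Re (cinner x y)"

class chilbert_space = complex_inner + complete_space

lemma scaleC_one: "1 *\<^sub>C x = (x :: 'a :: complex_inner)"
  using scaleR_scaleC[of 1 x] by simp

global_interpretation complex_vector: vector_space "scaleC :: complex \<Rightarrow> 'a \<Rightarrow> 'a :: complex_inner"
  by unfold_locales (simp_all add: scaleC_add_right scaleC_add_left scaleC_scaleC scaleC_one)

lemma cinner_self: "cinner x x = complex_of_real ((norm x)\<^sup>2)"
proof (rule complex_eqI)
  show "Im (cinner x x) = Im (complex_of_real ((norm x)\<^sup>2))"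
    using arg_cong[OF cinner_commute[of x x], of Im] by simp
qed (simp add: power2_norm_eq_inner inner_eq_Re_cinner)

instantiation complex :: chilbert_space
begin

definition scaleC_complex :: "complex \<Rightarrow> complex \<Rightarrow> complex"
  where "scaleC_complex c x = c * x"

definition cinner_complex :: "complex \<Rightarrow> complex \<Rightarrow> complex"
  where "cinner_complex x y = x * cnj y"

instance
  by standard
    (simp_all add: scaleC_complex_def cinner_complex_def inner_complex_def algebra_simps
      scaleR_conv_of_real)

end


section \<open>Subspaces and orthogonality\<close>

definition closed_csubspace :: "'a :: complex_inner set \<Rightarrow> bool"
  where "closed_csubspace M \<longleftrightarrow> complex_vector.subspace M \<and> closed M"

definition orthogonal_sets :: "'a :: complex_inner set \<Rightarrow> 'a set \<Rightarrow> bool"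
  where "orthogonal_sets A B \<longleftrightarrow> (\<forall>x\<in>A. \<forall>y\<in>B. cinner x y = 0)"

definition orthogonal_complement :: "'a :: complex_inner set \<Rightarrow> 'a set"
  where "orthogonal_complement A = {x. \<forall>y\<in>A. cinner x y = 0}"

text \<open>\<open>H = M \<oplus> N\<close> for the whole space \<open>H\<close>.\<close>

definition orthogonal_decomposition :: "'a :: complex_inner set \<Rightarrow> 'a set \<Rightarrow> bool"
  where "orthogonal_decomposition M N \<longleftrightarrow>
    closed_csubspace M \<and> closed_csubspace N \<and> orthogonal_sets M N \<and>
    (UNIV = {x + y | x y. x \<in> M \<and> y \<in> N})"

text \<open>
  \<open>M\<close> is the (internal) orthogonal Hilbert space direct sum of the closed subspaces \<open>V k\<close>: its
  elements are the sums of the norm-convergent series with \<open>k\<close>-th term in \<open>V k\<close>.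
\<close>

definition hilbert_direct_sum :: "(nat \<Rightarrow> 'a :: complex_inner set) \<Rightarrow> 'a set \<Rightarrow> bool"
  where "hilbert_direct_sum V M \<longleftrightarrow>
    (\<forall>k. closed_csubspace (V k)) \<and>
    (\<forall>k l. k \<noteq> l \<longrightarrow> orthogonal_sets (V k) (V l)) \<and>
    M = {x. \<exists>f. (\<forall>k. f k \<in> V k) \<and> f sums x}"


section \<open>Operators\<close>

text \<open>
  \<open>T\<close> restricts to a bounded operator on the subspace \<open>M\<close>, i.e. to an element of \<open>B(M)\<close>;
  the values of \<open>T\<close> outside \<open>M\<close> are irrelevant.
\<close>

definition bounded_operator_on :: "'a :: complex_inner set \<Rightarrow> ('a \<Rightarrow> 'a) \<Rightarrow> bool"
  where "bounded_operator_on M T \<longleftrightarrow>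
    T ` M \<subseteq> M \<and>
    (\<forall>x\<in>M. \<forall>y\<in>M. T (x + y) = T x + T y) \<and>
    (\<forall>c. \<forall>x\<in>M. T (c *\<^sub>C x) = c *\<^sub>C T x) \<and>
    (\<exists>K. \<forall>x\<in>M. norm (T x) \<le> K * norm x)"

abbreviation bounded_operator :: "('a :: complex_inner \<Rightarrow> 'a) \<Rightarrow> bool"
  where "bounded_operator \<equiv> bounded_operator_on UNIV"

text \<open>Meaningful for bounded operators on a Hilbert space, where the adjoint exists and is unique.\<close>

definition cadjoint :: "('a :: complex_inner \<Rightarrow> 'a) \<Rightarrow> 'a \<Rightarrow> 'a"
  where "cadjoint T = (THE S. \<forall>x y. cinner (T x) y = cinner x (S y))"

definition near_isometry :: "('a :: chilbert_space \<Rightarrow> 'a) \<Rightarrow> bool"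
  where "near_isometry T \<longleftrightarrow>
    bounded_operator T \<and>
    (\<exists>\<delta>>0. \<forall>x. \<delta> * norm x \<le> norm (T x) \<and> norm (T x) \<le> norm x) \<and>
    (\<forall>k\<ge>1. range (\<lambda>x. (cadjoint T ^^ k) ((T ^^ (k + 1)) x)) \<subseteq> range T)"

definition reducing_subspace :: "('a :: chilbert_space \<Rightarrow> 'a) \<Rightarrow> 'a set \<Rightarrow> bool"
  where "reducing_subspace T M \<longleftrightarrow>
    closed_csubspace M \<and> T ` M \<subseteq> M \<and>
    T ` orthogonal_complement M \<subseteq> orthogonal_complement M"

definition wandering_subspace :: "('a :: chilbert_space \<Rightarrow> 'a) \<Rightarrow> 'a set \<Rightarrow> bool"
  where "wandering_subspace T W \<longleftrightarrow>
    closed_csubspace W \<and>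
    (\<forall>k l. k \<noteq> l \<longrightarrow> orthogonal_sets ((T ^^ k) ` W) ((T ^^ l) ` W))"

text \<open>
  The next two notions concern the restriction of \<open>T\<close> to \<open>M\<close>.  On \<open>W \<subseteq> M\<close> the powers of the
  restriction agree with those of \<open>T\<close>.
\<close>

definition shift_on :: "'a :: chilbert_space set \<Rightarrow> ('a \<Rightarrow> 'a) \<Rightarrow> bool"
  where "shift_on M T \<longleftrightarrow>
    bounded_operator_on M T \<and>
    (\<exists>W\<subseteq>M. wandering_subspace T W \<and> hilbert_direct_sum (\<lambda>k. (T ^^ k) ` W) M)"

definition invertible_on :: "'a :: chilbert_space set \<Rightarrow> ('a \<Rightarrow> 'a) \<Rightarrow> bool"
  where "invertible_on M T \<longleftrightarrow>
    bounded_operator_on M T \<and>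
    (\<exists>S. bounded_operator_on M S \<and> (\<forall>x\<in>M. S (T x) = x \<and> T (S x) = x))"

end

theory Submission imports Defs begin

text \<open>
  Let \<open>W = H \<ominus> T H\<close>.  The proof is that of the Wold decomposition of an isometry, where the
  range condition on \<open>T\<close> replaces the identity \<open>T\<^sup>* T = 1\<close>: for \<open>w \<in> W\<close>,
  \<open>\<langle>T\<^sup>m w, T\<^sup>m\<^sup>+\<^sup>1 y\<rangle> = \<langle>w, T\<^sup>*\<^sup>m T\<^sup>m\<^sup>+\<^sup>1 y\<rangle> = 0\<close> because the vector on the right lies in \<open>T H\<close>
  (\<open>near_isometry_defect_orthogonal\<close>).  Hence \<open>T\<^sup>m W \<perp> T\<^sup>n H\<close> for all \<open>m < n\<close>, and in particular \<open>W\<close>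
  is wandering.

  As \<open>T\<close> is bounded below, \<open>T\<close> and its powers map closed subspaces to closed subspaces.  Applying
  \<open>T\<^sup>m\<close> to \<open>H = W \<oplus> T H\<close> gives \<open>T\<^sup>m H = T\<^sup>m W \<oplus> T\<^sup>m\<^sup>+\<^sup>1 H\<close>, again an orthogonal sum, so
  \<open>H = W \<oplus> T W \<oplus> \<dots> \<oplus> T\<^sup>n\<^sup>-\<^sup>1 W \<oplus> T\<^sup>n H\<close>.  A vector is therefore orthogonal to all \<open>T\<^sup>m W\<close>
  exactly if it lies in every \<open>T\<^sup>n H\<close> (\<open>orthogonal_complement_wandering\<close>).  In a complete space, the
  sums of convergent series with terms in an orthogonal sequence of closed subspaces, together with
  the vectors orthogonal to all those subspaces, decompose the space
  (\<open>orthogonal_family_decomposition\<close>).  So \<open>H = H\<^sub>0 \<oplus> H\<^sub>1\<close> with \<open>H\<^sub>0 = \<Oplus> T\<^sup>m W\<close> and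
  \<open>H\<^sub>1 = \<Inter> T\<^sup>m H\<close>.  Both are invariant under \<open>T\<close> and each is the orthogonal complement of the other,
  so both reduce \<open>T\<close>.  On \<open>H\<^sub>1\<close>, \<open>T\<close> is onto and bounded below, hence invertible.

  The two facts about Hilbert spaces behind this, orthogonal projection to closed subspaces and the
  existence of adjoints, are derived from completeness first.
\<close>

section \<open>Complex inner products\<close>

instance chilbert_space \<subseteq> banach ..

lemma cinner_zero_left [simp]: "cinner 0 (y :: 'a :: complex_inner) = 0"
  using cinner_add_left[of 0 0 y] by simp

lemma cinner_add_right: "cinner (x :: 'a :: complex_inner) (y + z) = cinner x y + cinner x z"
  using cinner_commute[of x] by (metis cinner_add_left complex_cnj_add)

lemma cinner_scaleC_right: "cinner (x :: 'a :: complex_inner) (c *\<^sub>C y) = cnj c * cinner x y"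
  using cinner_commute[of x] by (metis cinner_scaleC_left complex_cnj_mult)

lemma cinner_eq_0_sym: "cinner (x :: 'a :: complex_inner) y = 0 \<longleftrightarrow> cinner y x = 0"
  using cinner_commute[of x y] by simp

lemma cinner_zero_right [simp]: "cinner (y :: 'a :: complex_inner) 0 = 0"
  by (simp add: cinner_eq_0_sym[of y])

lemma cinner_diff_left: "cinner (x - y :: 'a :: complex_inner) z = cinner x z - cinner y z"
  using cinner_add_left[of "x - y" y z] by (simp add: algebra_simps)

lemma cinner_diff_right: "cinner (z :: 'a :: complex_inner) (x - y) = cinner z x - cinner z y"
  using cinner_add_right[of z "x - y" y] by (simp add: algebra_simps)

lemma cinner_sum_left: "cinner (sum f A) (z :: 'a :: complex_inner) = (\<Sum>i\<in>A. cinner (f i) z)"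
  by (induction A rule: infinite_finite_induct) (simp_all add: cinner_add_left)

lemma cinner_self_eq_0 [simp]: "cinner (x :: 'a :: complex_inner) x = 0 \<longleftrightarrow> x = 0"
  by (simp add: cinner_self)

lemma inner_eq_0_if_cinner: "cinner (x :: 'a :: complex_inner) y = 0 \<Longrightarrow> inner x y = 0"
  by (simp add: inner_eq_Re_cinner)

text \<open>Multiplying by \<open>\<i>\<close> swaps real and imaginary parts, so the complex inner product is made of
  two real ones; its continuity and its vanishing on complex subspaces thus reduce to the real case.\<close>

lemma cinner_eq_Complex_inner:
  "cinner (x :: 'a :: complex_inner) y = complex_of_real (inner x y) + \<i> * complex_of_real (inner x (\<i> *\<^sub>C y))"
  by (rule complex_eqI) (simp_all add: inner_eq_Re_cinner cinner_scaleC_right)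

lemma bounded_linear_cinner_left: "bounded_linear (\<lambda>x :: 'a :: complex_inner. cinner x y)"
  unfolding cinner_eq_Complex_inner
  by (intro bounded_linear_add bounded_linear_const_mult
      bounded_linear_compose[OF bounded_linear_of_real] bounded_linear_inner_left)

lemma csubspace_imp_subspace:
  "complex_vector.subspace M \<Longrightarrow> subspace (M :: 'a :: complex_inner set)"
  by (simp add: complex_vector.subspace_def subspace_def scaleR_scaleC)

lemma closed_csubspace_UNIV: "closed_csubspace (UNIV :: 'a :: complex_inner set)"
  by (simp add: closed_csubspace_def)

lemma closed_csubspace_orthogonal_complement:
  "closed_csubspace (orthogonal_complement (A :: 'a :: complex_inner set))"
proof -
  have "closed {x :: 'a. cinner x y = 0}" for y
    using continuous_closed_preimage_constant[OF linear_continuous_on[OF bounded_linear_cinner_left], of UNIV y 0]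
    by simp
  moreover have "orthogonal_complement A = (\<Inter>y\<in>A. {x. cinner x y = 0})"
    by (auto simp: orthogonal_complement_def)
  ultimately have "closed (orthogonal_complement A)"
    by auto
  then show ?thesis
    by (simp add: closed_csubspace_def complex_vector.subspace_def orthogonal_complement_def
        cinner_add_left cinner_scaleC_left)
qed

section \<open>Orthogonal projection and direct sums\<close>

lemma parallelogram_law:
  "(norm (a + b))\<^sup>2 + (norm (b - a))\<^sup>2 = 2 * (norm a)\<^sup>2 + 2 * (norm (b :: 'a :: real_inner))\<^sup>2"
  by (simp add: power2_norm_eq_inner inner_add_left inner_add_right inner_diff_left
      inner_diff_right inner_commute)

text \<open>By the parallelogram law, points of a subspace that are nearly closest to \<open>x\<close> are close to
  each other, so a minimising sequence converges by completeness.\<close>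

lemma nearest_point_exists:
  fixes M :: "'a :: chilbert_space set"
  assumes "closed_csubspace M"
  shows "\<exists>p\<in>M. \<forall>y\<in>M. norm (x - p) \<le> norm (x - y)"
proof -
  have sub: "subspace M" and cl: "closed M"
    using assms by (auto simp: closed_csubspace_def csubspace_imp_subspace)
  define d where "d = (INF y\<in>M. (norm (x - y))\<^sup>2)"
  have bdd: "bdd_below ((\<lambda>y. (norm (x - y))\<^sup>2) ` M)"
    by (rule bdd_belowI2[of _ 0]) simp
  have ne: "M \<noteq> {}"
    using subspace_0[OF sub] by auto
  have d_le: "d \<le> (norm (x - y))\<^sup>2" if "y \<in> M" for y
    unfolding d_def by (rule cINF_lower[OF bdd that])
  have "\<exists>y\<in>M. (norm (x - y))\<^sup>2 < d + inverse (real (Suc n))" for n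
    using cINF_less_iff[OF ne bdd, of "d + inverse (real (Suc n))"] unfolding d_def by simp
  then obtain Y where Y: "\<And>n. Y n \<in> M" "\<And>n. (norm (x - Y n))\<^sup>2 < d + inverse (real (Suc n))"
    by metis
  have close: "(norm (Y m - Y n))\<^sup>2 \<le> 2 * inverse (real (Suc m)) + 2 * inverse (real (Suc n))" for m n
  proof -
    \<comment> \<open>The midpoint is no closer to \<open>x\<close> than the infimum, which bounds one diagonal from below.\<close>
    have "(1/2) *\<^sub>R (Y m + Y n) \<in> M"
      using sub Y by (intro subspace_scale subspace_add)
    then have "4 * d \<le> 4 * (norm (x - (1/2) *\<^sub>R (Y m + Y n)))\<^sup>2"
      using d_le by auto
    also have "\<dots> = (norm (2 *\<^sub>R (x - (1/2) *\<^sub>R (Y m + Y n))))\<^sup>2"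
      by (simp only: norm_scaleR power_mult_distrib) simp
    also have "2 *\<^sub>R (x - (1/2) *\<^sub>R (Y m + Y n)) = (x - Y m) + (x - Y n)"
      by (simp add: algebra_simps scaleR_2)
    finally have 1: "4 * d \<le> (norm ((x - Y m) + (x - Y n)))\<^sup>2" .
    have "(norm ((x - Y m) + (x - Y n)))\<^sup>2 + (norm ((x - Y n) - (x - Y m)))\<^sup>2
        = 2 * (norm (x - Y m))\<^sup>2 + 2 * (norm (x - Y n))\<^sup>2"
      by (rule parallelogram_law)
    then show ?thesis
      using 1 Y(2)[of m] Y(2)[of n] by simp
  qed
  have "Cauchy Y"
  proof (rule CauchyI)
    fix e :: real
    assume "0 < e"
    then obtain N where N: "inverse (real (Suc N)) < e\<^sup>2 / 4"
      using reals_Archimedean[of "e\<^sup>2 / 4"] by auto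
    have "norm (Y m - Y n) < e" if "m \<ge> N" "n \<ge> N" for m n
    proof (rule power2_less_imp_less)
      have "inverse (real (Suc m)) \<le> inverse (real (Suc N))"
           "inverse (real (Suc n)) \<le> inverse (real (Suc N))"
        using that by (auto intro!: le_imp_inverse_le)
      then show "(norm (Y m - Y n))\<^sup>2 < e\<^sup>2"
        using close[of m n] N by linarith
    qed (use \<open>0 < e\<close> in simp)
    then show "\<exists>M. \<forall>m\<ge>M. \<forall>n\<ge>M. norm (Y m - Y n) < e"
      by blast
  qed
  then obtain p where p: "Y \<longlonglongrightarrow> p"
    by (auto simp: Cauchy_convergent_iff convergent_def)
  have "p \<in> M"
    using closed_sequentially[OF cl Y(1) p] .
  moreover have "norm (x - p) \<le> norm (x - y)" if "y \<in> M" for y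
  proof -
    have "(\<lambda>n. (norm (x - Y n))\<^sup>2) \<longlonglongrightarrow> (norm (x - p))\<^sup>2"
      by (intro tendsto_intros p)
    moreover have "(\<lambda>n. d + inverse (real (Suc n))) \<longlonglongrightarrow> d + 0"
      by (intro tendsto_intros LIMSEQ_inverse_real_of_nat)
    ultimately have "(norm (x - p))\<^sup>2 \<le> d + 0"
      by (rule LIMSEQ_le) (use Y(2) in \<open>auto intro: less_imp_le\<close>)
    then have "(norm (x - p))\<^sup>2 \<le> (norm (x - y))\<^sup>2"
      using d_le[OF that] by linarith
    then show ?thesis
      by (rule power2_le_imp_le) simp
  qed
  ultimately show ?thesis
    by blast
qed

text \<open>If \<open>x - p\<close> had a component along some \<open>y \<in> M\<close>, moving \<open>p\<close> in the direction of \<open>y\<close> would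
  bring it closer to \<open>x\<close>.\<close>

lemma orthogonal_projection_exists:
  fixes M :: "'a :: chilbert_space set"
  assumes "closed_csubspace M"
  shows "\<exists>p\<in>M. x - p \<in> orthogonal_complement M"
proof -
  have csub: "complex_vector.subspace M"
    using assms by (simp add: closed_csubspace_def)
  then have sub: "subspace M"
    by (rule csubspace_imp_subspace)
  obtain p where p: "p \<in> M" and min: "\<And>y. y \<in> M \<Longrightarrow> norm (x - p) \<le> norm (x - y)"
    using nearest_point_exists[OF assms] by blast
  have real: "inner (x - p) y = 0" if "y \<in> M" for y
  proof (rule ccontr)
    assume nz: "inner (x - p) y \<noteq> 0"
    then have pos: "inner y y > 0"
      by auto
    \<comment> \<open>This \<open>t\<close> minimises the distance from \<open>x\<close> to \<open>p + t *\<^sub>R y\<close>.\<close>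
    define t where "t = inner (x - p) y / inner y y"
    have "p + t *\<^sub>R y \<in> M"
      using sub p that by (intro subspace_add subspace_scale)
    then have "(norm (x - p))\<^sup>2 \<le> (norm ((x - p) - t *\<^sub>R y))\<^sup>2"
      using min[of "p + t *\<^sub>R y"] by (simp add: algebra_simps power_mono)
    also have "\<dots> = (norm (x - p))\<^sup>2 - 2 * t * inner (x - p) y + t * t * inner y y"
      by (simp only: power2_norm_eq_inner inner_diff_left[of "x - p"] inner_diff_right[of _ "x - p"]
          inner_scaleR_left inner_scaleR_right inner_commute[of y "x - p"])
        (simp add: algebra_simps)
    also have "\<dots> = (norm (x - p))\<^sup>2 - (inner (x - p) y)\<^sup>2 / inner y y"
      using pos by (simp add: t_def power2_eq_square field_simps)
    finally show False
      using nz pos by (simp add: divide_le_0_iff)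
  qed
  have "cinner (x - p) y = 0" if "y \<in> M" for y
    using real[OF that] real[of "\<i> *\<^sub>C y"] that csub
    by (simp add: cinner_eq_Complex_inner complex_vector.subspace_scale)
  then show ?thesis
    using p by (auto simp: orthogonal_complement_def)
qed

lemma orthogonal_decomposition_orthogonal_complement:
  assumes "orthogonal_sets M N" and "\<And>x :: 'a :: complex_inner. \<exists>y\<in>M. \<exists>z\<in>N. x = y + z"
  shows "orthogonal_complement M = N" and "orthogonal_complement N = M"
proof -
  have MN: "cinner y z = 0" "cinner z y = 0" if "y \<in> M" "z \<in> N" for y z
    using assms(1) that by (auto simp: orthogonal_sets_def cinner_eq_0_sym)
  have "x \<in> N" if "x \<in> orthogonal_complement M" for x
  proof -
    obtain y z where yz: "y \<in> M" "z \<in> N" "x = y + z"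
      using assms(2) by blast
    have "cinner x y = 0"
      using that yz(1) by (simp add: orthogonal_complement_def)
    then have "cinner y y = 0"
      using yz MN by (simp add: cinner_add_left)
    then show ?thesis
      using yz by simp
  qed
  then show "orthogonal_complement M = N"
    using MN by (auto simp: orthogonal_complement_def)
  have "x \<in> M" if "x \<in> orthogonal_complement N" for x
  proof -
    obtain y z where yz: "y \<in> M" "z \<in> N" "x = y + z"
      using assms(2) by blast
    have "cinner x z = 0"
      using that yz(2) by (simp add: orthogonal_complement_def)
    then have "cinner z z = 0"
      using yz MN by (simp add: cinner_add_left)
    then show ?thesis
      using yz by simp
  qed
  then show "orthogonal_complement N = M"
    using MN by (auto simp: orthogonal_complement_def)
qed

text \<open>Pythagoras turns convergence of the series into convergence of the real series of squared
  norms.\<close>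

lemma orthogonal_summable:
  fixes f :: "nat \<Rightarrow> 'a :: chilbert_space"
  assumes orth: "\<And>i j. i \<noteq> j \<Longrightarrow> cinner (f i) (f j) = 0"
    and bound: "\<And>n. (norm (\<Sum>k<n. f k))\<^sup>2 \<le> C"
  shows "summable f"
proof -
  have pyth: "(norm (sum f A))\<^sup>2 = (\<Sum>k\<in>A. (norm (f k))\<^sup>2)" if "finite A" for A
    using that orth
    by (intro norm_sum_Pythagorean) (auto simp: pairwise_def orthogonal_def inner_eq_0_if_cinner)
  have "summable (\<lambda>k. (norm (f k))\<^sup>2)"
    by (rule bounded_imp_summable[where B = C])
      (use pyth[of "{.._}"] bound[of "Suc _"] in \<open>simp_all add: lessThan_Suc_atMost\<close>)
  then have sq: "\<exists>N. \<forall>m\<ge>N. \<forall>n. norm (\<Sum>k=m..<n. (norm (f k))\<^sup>2) < e" if "e > 0" for e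
    using that by (simp add: summable_Cauchy)
  show ?thesis
    unfolding summable_Cauchy
  proof (intro allI impI)
    fix e :: real
    assume "e > 0"
    then obtain N where N: "\<And>m n. m \<ge> N \<Longrightarrow> norm (\<Sum>k=m..<n. (norm (f k))\<^sup>2) < e\<^sup>2"
      using sq[of "e\<^sup>2"] by auto
    have "norm (sum f {m..<n}) < e" if "m \<ge> N" for m n
      by (rule power2_less_imp_less) (use N[OF that, of n] pyth[of "{m..<n}"] \<open>e > 0\<close> in auto)
    then show "\<exists>N. \<forall>m\<ge>N. \<forall>n. norm (sum f {m..<n}) < e"
      by blast
  qed
qed

text \<open>The projections of \<open>x\<close> to the summands form a convergent series by Bessel's inequality, and
  what its sum misses is orthogonal to every summand.\<close>

lemma hilbert_direct_sum_projection:
  fixes V :: "nat \<Rightarrow> 'a :: chilbert_space set"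
  assumes closed: "\<And>k. closed_csubspace (V k)"
    and orth: "\<And>k l. k \<noteq> l \<Longrightarrow> orthogonal_sets (V k) (V l)"
  shows "\<exists>f s. (\<forall>k. f k \<in> V k) \<and> f sums s \<and> x - s \<in> orthogonal_complement (\<Union>k. V k)"
proof -
  obtain f where fV: "\<And>k. f k \<in> V k" and fx: "\<And>k. x - f k \<in> orthogonal_complement (V k)"
    using orthogonal_projection_exists[of _ x, OF closed] by metis
  have VV: "cinner u v = 0" if "u \<in> V k" "v \<in> V l" "k \<noteq> l" for u v k l
    using orth that by (auto simp: orthogonal_sets_def)
  have coeff: "cinner (f k) v = cinner x v" if "v \<in> V k" for k v
    using fx[of k] that by (simp add: orthogonal_complement_def cinner_diff_left)
  \<comment> \<open>Bessel: each partial sum is orthogonal to the remainder of \<open>x\<close>.\<close>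
  have "(norm (\<Sum>k<n. f k))\<^sup>2 \<le> (norm x)\<^sup>2" for n
  proof -
    let ?s = "\<Sum>k<n. f k"
    have "cinner ?s (f j) = cinner x (f j)" if "j < n" for j
    proof -
      have "cinner ?s (f j) = (\<Sum>k<n. if k = j then cinner (f j) (f j) else 0)"
        unfolding cinner_sum_left by (intro sum.cong refl) (auto intro: VV[OF fV fV])
      also have "\<dots> = cinner (f j) (f j)"
        using that by simp
      finally show ?thesis
        using coeff[OF fV] by simp
    qed
    then have "cinner (f j) (x - ?s) = 0" if "j < n" for j
      using that by (subst cinner_eq_0_sym) (simp add: cinner_diff_left)
    then have "cinner ?s (x - ?s) = 0"
      by (simp add: cinner_sum_left)
    then have "inner ?s (x - ?s) = 0"
      by (rule inner_eq_0_if_cinner)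
    then have "(norm (?s + (x - ?s)))\<^sup>2 = (norm ?s)\<^sup>2 + (norm (x - ?s))\<^sup>2"
      by (intro norm_add_Pythagorean) (simp add: orthogonal_def)
    then show ?thesis
      by simp
  qed
  then have "summable f"
    by (intro orthogonal_summable[of f "(norm x)\<^sup>2"] VV[OF fV fV])
  then obtain s where s: "f sums s"
    by (auto simp: summable_def)
  \<comment> \<open>Only the \<open>j\<close>-th term of the series contributes to the inner product of \<open>s\<close> with \<open>v\<close>.\<close>
  have "cinner (x - s) v = 0" if v: "v \<in> V j" for j v
  proof -
    have "(\<lambda>k. cinner (f k) v) sums cinner s v"
      by (rule bounded_linear.sums[OF bounded_linear_cinner_left s])
    moreover have "(\<lambda>k. cinner (f k) v) = (\<lambda>k. if k = j then cinner (f k) v else 0)"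
      using VV[OF fV v] by auto
    ultimately have "cinner s v = cinner (f j) v"
      using sums_single[of j "\<lambda>k. cinner (f k) v"] sums_unique2 by metis
    then show ?thesis
      using coeff[OF v] by (simp add: cinner_diff_left)
  qed
  then show ?thesis
    using fV s by (auto simp: orthogonal_complement_def)
qed

text \<open>The set of sums is the orthogonal complement of a set, which is why it is a closed
  subspace.\<close>

lemma orthogonal_family_decomposition:
  fixes V :: "nat \<Rightarrow> 'a :: chilbert_space set"
  assumes closed: "\<And>k. closed_csubspace (V k)"
    and orth: "\<And>k l. k \<noteq> l \<Longrightarrow> orthogonal_sets (V k) (V l)"
  defines "M \<equiv> {x. \<exists>f. (\<forall>k. f k \<in> V k) \<and> f sums x}"
  defines "N \<equiv> orthogonal_complement (\<Union>k. V k)"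
  shows "hilbert_direct_sum V M" and "orthogonal_decomposition M N"
    and "orthogonal_complement M = N" and "orthogonal_complement N = M"
proof -
  show "hilbert_direct_sum V M"
    using closed orth by (simp add: hilbert_direct_sum_def M_def)
  have MN: "orthogonal_sets M N"
    unfolding orthogonal_sets_def
  proof (intro ballI)
    fix x y
    assume "x \<in> M" and y: "y \<in> N"
    then obtain f where f: "\<And>k. f k \<in> V k" "f sums x"
      by (auto simp: M_def)
    have "cinner (f k) y = 0" for k
      using y f(1)[of k] by (subst cinner_eq_0_sym) (auto simp: N_def orthogonal_complement_def)
    then have "(\<lambda>_. 0) sums cinner x y"
      using bounded_linear.sums[OF bounded_linear_cinner_left f(2), of y] by simp
    then show "cinner x y = 0"
      using sums_unique2 sums_zero by blast
  qed
  have split: "\<exists>y\<in>M. \<exists>z\<in>N. x = y + z" for x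
  proof -
    obtain f s where "\<And>k. f k \<in> V k" "f sums s" "x - s \<in> N"
      using hilbert_direct_sum_projection[of V x, OF closed orth] unfolding N_def by blast
    then have "s \<in> M" "x = s + (x - s)"
      by (auto simp: M_def)
    then show ?thesis
      using \<open>x - s \<in> N\<close> by blast
  qed
  show 1: "orthogonal_complement M = N" and 2: "orthogonal_complement N = M"
    using orthogonal_decomposition_orthogonal_complement[OF MN split] by blast+
  have "closed_csubspace M" "closed_csubspace N"
    using closed_csubspace_orthogonal_complement[of N] closed_csubspace_orthogonal_complement[of M]
    by (simp_all add: 1 2)
  then show "orthogonal_decomposition M N"
    using MN split by (simp add: orthogonal_decomposition_def set_eq_iff) blast
qed

section \<open>Adjoints\<close>

text \<open>A nonzero functional is determined by its kernel up to a factor, and the kernel has an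
  orthogonal vector because it is a proper closed subspace.\<close>

lemma riesz_representation:
  fixes f :: "'a :: chilbert_space \<Rightarrow> complex"
  assumes bl: "bounded_linear f" and homogeneous: "\<And>c x. f (c *\<^sub>C x) = c * f x"
  shows "\<exists>z. \<forall>x. f x = cinner x z"
proof (cases "\<forall>x. f x = 0")
  case True
  then show ?thesis
    by (intro exI[of _ 0]) simp
next
  case False
  then obtain x0 where x0: "f x0 \<noteq> 0"
    by blast
  interpret bounded_linear f
    by (rule bl)
  let ?K = "{x. f x = 0}"
  have "closed ?K"
    using continuous_closed_preimage_constant[OF linear_continuous_on[OF bl], of UNIV 0] by simp
  then have K: "closed_csubspace ?K"
    by (simp add: closed_csubspace_def complex_vector.subspace_def add homogeneous zero)
  obtain p where p: "f p = 0" "x0 - p \<in> orthogonal_complement ?K"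
    using orthogonal_projection_exists[OF K] by blast
  define e where "e = inverse (f x0) *\<^sub>C (x0 - p)"
  have fe: "f e = 1"
    using x0 p by (simp add: e_def homogeneous diff)
  have Ke: "cinner y e = 0" if "f y = 0" for y
    using p(2) that by (subst cinner_eq_0_sym) (simp add: e_def cinner_scaleC_left orthogonal_complement_def)
  have ne: "norm e \<noteq> 0"
    using fe zero by auto
  \<comment> \<open>The factor is fixed by \<open>f e = 1\<close>, as \<open>x - f x *\<^sub>C e\<close> lies in the kernel.\<close>
  have "cinner x (inverse (complex_of_real ((norm e)\<^sup>2)) *\<^sub>C e) = f x" for x
  proof -
    have "cinner (x - f x *\<^sub>C e) e = 0"
      by (rule Ke) (simp add: diff homogeneous fe)
    then have "cinner x e = f x * complex_of_real ((norm e)\<^sup>2)"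
      by (simp add: cinner_diff_left cinner_scaleC_left cinner_self)
    then show ?thesis
      using ne by (simp add: cinner_scaleC_right)
  qed
  then show ?thesis
    by metis
qed

lemma bounded_operator_imp_bounded_linear:
  assumes "bounded_operator (T :: 'a :: complex_inner \<Rightarrow> 'a)"
  shows "bounded_linear T"
proof -
  obtain K where K: "\<And>x. norm (T x) \<le> K * norm x"
    using assms by (auto simp: bounded_operator_on_def)
  show ?thesis
    by (rule bounded_linear_intro[where K = K])
      (use assms K in \<open>auto simp: bounded_operator_on_def scaleR_scaleC mult.commute\<close>)
qed

lemma cinner_cadjoint:
  fixes T :: "'a :: chilbert_space \<Rightarrow> 'a"
  assumes "bounded_operator T"
  shows "cinner (T x) y = cinner x (cadjoint T y)"
proof -
  have "\<exists>z. \<forall>x. cinner (T x) y = cinner x z" for y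
  proof (rule riesz_representation)
    show "bounded_linear (\<lambda>x. cinner (T x) y)"
      by (rule bounded_linear_compose[OF bounded_linear_cinner_left
            bounded_operator_imp_bounded_linear[OF assms]])
    show "cinner (T (c *\<^sub>C x)) y = c * cinner (T x) y" for c x
      using assms by (simp add: bounded_operator_on_def cinner_scaleC_left)
  qed
  then obtain S where S: "\<And>x y. cinner (T x) y = cinner x (S y)"
    by metis
  have "R = S" if R: "\<forall>x y. cinner (T x) y = cinner x (R y)" for R
  proof
    fix y
    have "cinner (R y - S y) (R y - S y) = 0"
      using R S[of "R y - S y" y] by (simp add: cinner_diff_right)
    then show "R y = S y"
      by simp
  qed
  then have "cadjoint T = S"
    unfolding cadjoint_def using S by (intro the_equality) auto
  then show ?thesis
    using S by simp
qed

lemma cinner_cadjoint_funpow: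
  fixes T :: "'a :: chilbert_space \<Rightarrow> 'a"
  assumes "bounded_operator T"
  shows "cinner ((T ^^ k) x) y = cinner x ((cadjoint T ^^ k) y)"
proof (induction k arbitrary: y)
  case (Suc k)
  show ?case
    by (simp add: cinner_cadjoint[OF assms] Suc.IH funpow_swap1[of "cadjoint T"])
qed simp

text \<open>This is where the range condition on a near-isometry enters: for \<open>w \<perp> T H\<close> one has
  \<open>\<langle>T\<^sup>m w, T\<^sup>m\<^sup>+\<^sup>1 y\<rangle> = \<langle>w, T\<^sup>*\<^sup>m T\<^sup>m\<^sup>+\<^sup>1 y\<rangle>\<close>, and the second argument lies in \<open>T H\<close>.  For \<open>m = 0\<close>
  there is nothing to show.\<close>

lemma near_isometry_defect_orthogonal:
  fixes T :: "'a :: chilbert_space \<Rightarrow> 'a"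
  assumes T: "near_isometry T" and w: "w \<in> orthogonal_complement (range T)"
  shows "cinner ((T ^^ m) w) ((T ^^ Suc m) y) = 0"
proof -
  have "(cadjoint T ^^ m) ((T ^^ Suc m) y) \<in> range T"
  proof (cases "m = 0")
    case False
    then have "range (\<lambda>x. (cadjoint T ^^ m) ((T ^^ (m + 1)) x)) \<subseteq> range T"
      using T unfolding near_isometry_def by (metis One_nat_def Suc_leI neq0_conv)
    then show ?thesis
      by auto
  qed auto
  moreover have "bounded_operator T"
    using T by (simp add: near_isometry_def)
  ultimately show ?thesis
    using w by (simp only: cinner_cadjoint_funpow orthogonal_complement_def mem_Collect_eq)
qed

section \<open>Wold decomposition\<close>

text \<open>The lower bound keeps ranges closed, and the last assumption, which is immediate for an
  isometry, makes the successive images of the defect space \<open>W\<close> orthogonal.  This isolates the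
  geometry of the decomposition from adjoints.\<close>

locale wold_operator =
  fixes T :: "'a :: chilbert_space \<Rightarrow> 'a" and \<delta> :: real
  assumes bounded: "bounded_operator T"
    and delta_pos: "\<delta> > 0"
    and bounded_below: "\<delta> * norm x \<le> norm (T x)"
    and defect_orthogonal:
      "w \<in> orthogonal_complement (range T) \<Longrightarrow> cinner ((T ^^ m) w) ((T ^^ Suc m) y) = 0"
begin

abbreviation W :: "'a set"
  where "W \<equiv> orthogonal_complement (range T)"

definition shift_part :: "'a set"
  where "shift_part = {x. \<exists>f. (\<forall>k. f k \<in> (T ^^ k) ` W) \<and> f sums x}"

definition invertible_part :: "'a set"
  where "invertible_part = (\<Inter>m. range (T ^^ m))"

lemma T_bounded_linear: "bounded_linear T"
  by (rule bounded_operator_imp_bounded_linear[OF bounded])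

lemma T_scaleC: "T (c *\<^sub>C x) = c *\<^sub>C T x"
  using bounded by (simp add: bounded_operator_on_def)

lemma bounded_linear_funpow: "bounded_linear (T ^^ m)"
  by (induction m)
    (simp_all add: id_def comp_def bounded_linear_ident bounded_linear_compose[OF T_bounded_linear])

lemma funpow_add_arg: "(T ^^ m) (x + y) = (T ^^ m) x + (T ^^ m) y"
  by (rule linear_add[OF bounded_linear.linear[OF bounded_linear_funpow]])

lemma funpow_scaleC: "(T ^^ m) (c *\<^sub>C x) = c *\<^sub>C (T ^^ m) x"
  by (induction m) (simp_all add: T_scaleC)

lemma funpow_bounded_below: "\<delta> ^ m * norm x \<le> norm ((T ^^ m) x)"
proof (induction m)
  case (Suc m)
  have "\<delta> ^ Suc m * norm x \<le> \<delta> * norm ((T ^^ m) x)"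
    using Suc delta_pos by simp
  then show ?case
    using bounded_below[of "(T ^^ m) x"] by simp
qed simp

lemma inj_T: "inj T"
proof (rule injI)
  fix x y
  assume "T x = T y"
  then have "T (x - y) = 0"
    using linear_diff[OF bounded_linear.linear[OF T_bounded_linear], of x y] by simp
  then show "x = y"
    using bounded_below[of "x - y"] delta_pos by (simp add: mult_le_0_iff)
qed

text \<open>A Cauchy sequence in the image comes from a Cauchy sequence, as \<open>T\<close> is bounded below.\<close>

lemma closed_csubspace_funpow_image:
  assumes "closed_csubspace M"
  shows "closed_csubspace ((T ^^ m) ` M)"
proof -
  have csub: "complex_vector.subspace M" and cl: "closed M"
    using assms by (auto simp: closed_csubspace_def)
  have "complete ((T ^^ m) ` M)"
    using complete_isometric_image[of "\<delta> ^ m" M "T ^^ m"] delta_pos csubspace_imp_subspace[OF csub]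
      bounded_linear_funpow funpow_bounded_below cl
    by (simp add: complete_eq_closed)
  then have "closed ((T ^^ m) ` M)"
    by (simp add: complete_eq_closed)
  moreover have "complex_vector.subspace ((T ^^ m) ` M)"
  proof (rule complex_vector.subspaceI)
    show "0 \<in> (T ^^ m) ` M"
      using complex_vector.subspace_0[OF csub]
        linear_0[OF bounded_linear.linear[OF bounded_linear_funpow]] by (metis image_eqI)
    show "x + y \<in> (T ^^ m) ` M" if xy: "x \<in> (T ^^ m) ` M" "y \<in> (T ^^ m) ` M" for x y
      using xy complex_vector.subspace_add[OF csub] by (auto simp flip: funpow_add_arg)
    show "c *\<^sub>C x \<in> (T ^^ m) ` M" if x: "x \<in> (T ^^ m) ` M" for c x
      using x complex_vector.subspace_scale[OF csub] by (auto simp flip: funpow_scaleC)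
  qed
  ultimately show ?thesis
    by (simp add: closed_csubspace_def)
qed

lemma closed_csubspace_W: "closed_csubspace W"
  by (rule closed_csubspace_orthogonal_complement)

lemma defect_orthogonal_later:
  assumes "w \<in> W" and "m < n"
  shows "cinner ((T ^^ m) w) ((T ^^ n) y) = 0"
proof -
  have "n = Suc m + (n - Suc m)"
    using assms(2) by simp
  then have "(T ^^ n) y = (T ^^ Suc m) ((T ^^ (n - Suc m)) y)"
    by (metis comp_apply funpow_add)
  then show ?thesis
    using defect_orthogonal[OF assms(1)] by metis
qed

lemma wandering: "k \<noteq> l \<Longrightarrow> orthogonal_sets ((T ^^ k) ` W) ((T ^^ l) ` W)"
  unfolding orthogonal_sets_def
  using defect_orthogonal_later cinner_eq_0_sym by (metis imageE linorder_neqE_nat)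

text \<open>Since \<open>H = W \<oplus> T H\<close>, also \<open>T\<^sup>n H\<close> is the sum of \<open>T\<^sup>n W\<close> and \<open>T\<^sup>n\<^sup>+\<^sup>1 H\<close>, which are
  orthogonal.  So a vector of \<open>T\<^sup>n H\<close> orthogonal to \<open>T\<^sup>n W\<close> lies in \<open>T\<^sup>n\<^sup>+\<^sup>1 H\<close>.\<close>

lemma orthogonal_imp_in_range_funpow:
  assumes "\<And>k w. k < n \<Longrightarrow> w \<in> W \<Longrightarrow> cinner x ((T ^^ k) w) = 0"
  shows "x \<in> range (T ^^ n)"
  using assms
proof (induction n)
  case (Suc n)
  then obtain z where z: "x = (T ^^ n) z"
    by fastforce
  have "closed_csubspace (range T)"
    using closed_csubspace_funpow_image[OF closed_csubspace_UNIV, of 1] by simp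
  then obtain y where w: "z - T y \<in> W"
    using orthogonal_projection_exists[of "range T" z] by blast
  have x: "x = (T ^^ n) (z - T y) + (T ^^ Suc n) y"
    unfolding z using funpow_add_arg[of n "z - T y" "T y"] by (simp add: funpow_swap1)
  have "cinner x ((T ^^ n) (z - T y)) = 0"
    using Suc.prems[of n] w by simp
  moreover have "cinner ((T ^^ Suc n) y) ((T ^^ n) (z - T y)) = 0"
    using defect_orthogonal[OF w] cinner_eq_0_sym by blast
  ultimately have "(T ^^ n) (z - T y) = 0"
    by (subst (asm) x) (simp only: cinner_add_left add_0_right cinner_self_eq_0)
  then show ?case
    using x by simp
qed simp

lemma orthogonal_complement_wandering: "orthogonal_complement (\<Union>k. (T ^^ k) ` W) = invertible_part"
proof (intro equalityI subsetI)
  fix x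
  assume "x \<in> orthogonal_complement (\<Union>k. (T ^^ k) ` W)"
  then show "x \<in> invertible_part"
    using orthogonal_imp_in_range_funpow[of _ x]
    by (auto simp: orthogonal_complement_def invertible_part_def)
next
  fix x
  assume x: "x \<in> invertible_part"
  have "cinner x ((T ^^ k) w) = 0" if "w \<in> W" for k w
  proof -
    obtain y where "x = (T ^^ Suc k) y"
      using x unfolding invertible_part_def by blast
    then show ?thesis
      using defect_orthogonal[OF that, of k y] cinner_eq_0_sym by blast
  qed
  then show "x \<in> orthogonal_complement (\<Union>k. (T ^^ k) ` W)"
    unfolding orthogonal_complement_def by blast
qed

lemma decomposition:
  shows shift_part_sum: "hilbert_direct_sum (\<lambda>k. (T ^^ k) ` W) shift_part"
    and parts_decomposition: "orthogonal_decomposition shift_part invertible_part"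
    and complement_shift_part: "orthogonal_complement shift_part = invertible_part"
    and complement_invertible_part: "orthogonal_complement invertible_part = shift_part"
  using orthogonal_family_decomposition[of "\<lambda>k. (T ^^ k) ` W",
      OF closed_csubspace_funpow_image[OF closed_csubspace_W] wandering]
  by (simp_all add: orthogonal_complement_wandering flip: shift_part_def)

text \<open>The image of a series \<open>\<Sum>k. f k\<close> is the series with the terms moved by one place; the new
  zeroth term is \<open>0\<close>.\<close>

lemma shift_part_invariant: "T ` shift_part \<subseteq> shift_part"
proof (rule image_subsetI)
  fix x
  assume "x \<in> shift_part"
  then obtain f where f: "\<And>k. f k \<in> (T ^^ k) ` W" "f sums x"
    by (auto simp: shift_part_def)
  define g where "g = (\<lambda>k. case k of 0 \<Rightarrow> 0 | Suc j \<Rightarrow> T (f j))"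
  have "(\<lambda>k. g (Suc k)) sums T x"
    using bounded_linear.sums[OF T_bounded_linear f(2)] by (simp add: g_def)
  then have "g sums (T x + g 0)"
    by (rule sums_Suc)
  then have "g sums T x"
    by (simp add: g_def)
  moreover have "g k \<in> (T ^^ k) ` W" for k
  proof (cases k)
    case 0
    then show ?thesis
      by (simp add: g_def orthogonal_complement_def)
  next
    case (Suc j)
    then show ?thesis
      using f(1)[of j] by (auto simp: g_def)
  qed
  ultimately show "T x \<in> shift_part"
    by (auto simp: shift_part_def)
qed

lemma invertible_part_invariant: "T ` invertible_part \<subseteq> invertible_part"
proof (rule image_subsetI)
  fix x
  assume x: "x \<in> invertible_part"
  have "T x \<in> range (T ^^ m)" for m
  proof -
    obtain y where "x = (T ^^ m) y"
      using x unfolding invertible_part_def by blast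
    then have "T x = (T ^^ m) (T y)"
      by (simp add: funpow_swap1)
    then show ?thesis
      by blast
  qed
  then show "T x \<in> invertible_part"
    by (simp add: invertible_part_def)
qed

text \<open>The preimage \<open>y\<close> of \<open>x\<close> is unique, so writing \<open>x\<close> as an element of \<open>T\<^sup>m\<^sup>+\<^sup>1 H\<close> shows that
  the same \<open>y\<close> lies in \<open>T\<^sup>m H\<close>.\<close>

lemma invertible_part_preimage:
  assumes "x \<in> invertible_part"
  shows "inv T x \<in> invertible_part" and "T (inv T x) = x"
proof -
  have Suc: "\<exists>z. x = T ((T ^^ m) z)" for m
    using assms unfolding invertible_part_def by (metis INT_iff UNIV_I comp_apply funpow.simps(2) imageE)
  then have "inv T x \<in> range (T ^^ m)" for m
    using inj_T by (metis inv_f_f rangeI)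
  then show "inv T x \<in> invertible_part"
    by (simp add: invertible_part_def)
  show "T (inv T x) = x"
    using Suc by (metis f_inv_into_f rangeI)
qed

lemma bounded_operator_on_invariant: "T ` M \<subseteq> M \<Longrightarrow> bounded_operator_on M T"
  using bounded by (auto simp: bounded_operator_on_def)

lemma shift_on_shift_part: "shift_on shift_part T"
proof -
  have "x \<in> shift_part" if "x \<in> W" for x
  proof -
    let ?f = "\<lambda>k. if k = 0 then x else 0"
    have "?f sums x"
      using sums_single[of 0 "\<lambda>_. x"] by simp
    moreover have "?f k \<in> (T ^^ k) ` W" for k
      using that closed_csubspace_funpow_image[OF closed_csubspace_W, of k]
      by (auto simp: closed_csubspace_def complex_vector.subspace_0)
    ultimately show ?thesis
      unfolding shift_part_def by (intro CollectI exI[of _ ?f] conjI allI)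
  qed
  moreover have "wandering_subspace T W"
    using closed_csubspace_W wandering by (simp add: wandering_subspace_def)
  ultimately show ?thesis
    unfolding shift_on_def
    using shift_part_sum bounded_operator_on_invariant[OF shift_part_invariant] by blast
qed

lemma invertible_on_invertible_part: "invertible_on invertible_part T"
proof -
  have sub: "complex_vector.subspace invertible_part"
    using parts_decomposition by (simp add: orthogonal_decomposition_def closed_csubspace_def)
  have "inv T (x + y) = inv T x + inv T y" if "x \<in> invertible_part" "y \<in> invertible_part" for x y
    using that funpow_add_arg[of 1 "inv T x" "inv T y"] invertible_part_preimage(2) inj_T
    by (simp add: inv_f_eq)
  moreover have "inv T (c *\<^sub>C x) = c *\<^sub>C inv T x" if "x \<in> invertible_part" for c x
    using that T_scaleC invertible_part_preimage(2) inj_T by (simp add: inv_f_eq)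
  moreover have "norm (inv T x) \<le> (1 / \<delta>) * norm x" if "x \<in> invertible_part" for x
    using bounded_below[of "inv T x"] invertible_part_preimage(2)[OF that] delta_pos
    by (simp add: field_simps)
  ultimately have "bounded_operator_on invertible_part (inv T)"
    unfolding bounded_operator_on_def using invertible_part_preimage(1) by blast
  then show ?thesis
    unfolding invertible_on_def
    using bounded_operator_on_invariant[OF invertible_part_invariant] invertible_part_preimage(2)
      inv_f_f[OF inj_T] by blast
qed

end

theorem theorem3p3:
  fixes T :: "'a :: chilbert_space \<Rightarrow> 'a"
  assumes "near_isometry T"
  shows "\<exists>H0 H1.
    reducing_subspace T H0 \<and> reducing_subspace T H1 \<and>
    orthogonal_decomposition H0 H1 \<and>
    shift_on H0 T \<and> invertible_on H1 T \<and>
    hilbert_direct_sum (\<lambda>m. (T ^^ m) ` orthogonal_complement (range T)) H0 \<and>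
    H1 = (\<Inter>m. range (T ^^ m))"
proof -
  obtain \<delta> where "\<delta> > 0" "\<And>x. \<delta> * norm x \<le> norm (T x)"
    using assms by (auto simp: near_isometry_def)
  then interpret wold_operator T \<delta>
    using assms near_isometry_defect_orthogonal[OF assms]
    by unfold_locales (simp_all add: near_isometry_def)
  have "closed_csubspace shift_part" "closed_csubspace invertible_part"
    using parts_decomposition by (simp_all add: orthogonal_decomposition_def)
  then have "reducing_subspace T shift_part" "reducing_subspace T invertible_part"
    using shift_part_invariant invertible_part_invariant
    by (simp_all add: reducing_subspace_def complement_shift_part complement_invertible_part)
  then show ?thesis
    using parts_decomposition shift_on_shift_part invertible_on_invertible_part shift_part_sum
      invertible_part_def by blast
qed

end
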